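(* Let $\mathcal{X}$ be a set, $n\ge1$, $f:\mathcal{X}^n\to\mathbb{R}$ any function, and let $\{\bar U^\ell_f\}_{\ell\ge0}$, $\{\bar L^\ell_f\}_{\ell\ge0}$ be approximate upper and lower sensitivity bounding functions for $f$. Let $t_1,t_2,\dots$ be any stream of potential outputs in $\mathbb{R}$ and $\varepsilon_1,\varepsilon_2>0$. Consider the mechanism which on input $\mathbf{x}\in\mathcal{X}^n$ runs $\texttt{AboveThreshold}$ on $\mathbf{x}$ with query stream $q_i(\cdot)=\bar\rho_f(\cdot\,;t_i)$, $\Delta=1$, $T=0$ and parameters $\varepsilon_1,\varepsilon_2$, and, if the output is $\bot^{k-1}\top$, returns $t_k$. Then this mechanism is $(\varepsilon_1+2\varepsilon_2)$-differentially private, and it is $(\varepsilon_1+\varepsilon_2)$-differentially private if the query stream $\{\bar\rho_f(\cdot\,;t_i)\}_i$ is monotonic.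
   Context: For $\mathbf{x},\mathbf{x}'\in\mathcal{X}^n$, $d_{\mathrm{ham}}(\mathbf{x},\mathbf{x}')=|\{i:\mathbf{x}_i\neq\mathbf{x}'_i\}|$; neighboring means $d_{\mathrm{ham}}\le1$. A randomized mechanism $M$ is $\varepsilon$-differentially private if for all neighboring $\mathbf{x},\mathbf{x}'$ and measurable $S$, $\Pr[M(\mathbf{x})\in S]\le e^{\varepsilon}\Pr[M(\mathbf{x}')\in S]$. Exact output bounds: $U^\ell_f(\mathbf{x})=\sup\{f(\mathbf{x}'):d_{\mathrm{ham}}(\mathbf{x},\mathbf{x}')\le\ell\}$, $L^\ell_f(\mathbf{x})=\inf\{f(\mathbf{x}'):d_{\mathrm{ham}}(\mathbf{x},\mathbf{x}')\le\ell\}$. Functions $\bar U^\ell_f,\bar L^\ell_f:\mathcal{X}^n\to\mathbb{R}$ ($\ell=0,1,2,\dots$) are approximate upper and lower sensitivity bounding functions if for all $\ell\ge0$ and all neighboring $\mathbf{x},\mathbf{x}'$: $\bar U^\ell_f(\mathbf{x})\ge U^\ell_f(\mathbf{x})$, $\bar U^\ell_f(\mathbf{x})\le \bar U^{\ell+1}_f(\mathbf{x}')$, $\bar L^\ell_f(\mathbf{x})\le L^\ell_f(\mathbf{x})$, $\bar L^\ell_f(\mathbf{x})\ge\bar L^{\ell+1}_f(\mathbf{x}')$. $\overline{\mathrm{len}}_f(\mathbf{x};t)=\inf\{\ell\in\mathbb{Z}_{\ge0}:\bar L^\ell_f(\mathbf{x})\le t\le \bar U^\ell_f(\mathbf{x})\}$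 ($\inf\emptyset=+\infty$), and $\bar\rho_f(\mathbf{x};t)=\mathrm{sgn}(t-f(\mathbf{x}))(\overline{\mathrm{len}}_f(\mathbf{x};t)-\tfrac12)$ with $\mathrm{sgn}(0)=0$. $\texttt{AboveThreshold}$ (input $\mathbf{x}$, queries $q_1,q_2,\dots$, sensitivity $\Delta$, threshold $T$, parameters $\varepsilon_1,\varepsilon_2$): set $\hat T=T+Z$, $Z$ exponential with scale $\Delta/\varepsilon_1$ (density $(\varepsilon_1/\Delta)e^{-z\varepsilon_1/\Delta}$, $z\ge0$); for $i=1,2,\dots$ draw independent $\nu_i$ exponential with scale $\Delta/\varepsilon_2$; if $q_i(\mathbf{x})+\nu_i\ge\hat T$ output $\top$ and halt, else output $\bot$. A query stream $\{q_i\}$ is monotonic if for any neighboring $\mathbf{x},\mathbf{x}'$ either $q_i(\mathbf{x})\le q_i(\mathbf{x}')$ for all $i$ or $q_i(\mathbf{x})\ge q_i(\mathbf{x}')$ for all $i$. *)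

theory Defs
  imports "HOL-Probability.Probability"
begin

definition vectors :: "'a set \<Rightarrow> nat \<Rightarrow> 'a list set" where
  "vectors X n = {x. length x = n \<and> set x \<subseteq> X}"

text \<open>Only used for two lists of the same length.\<close>
definition hamming :: "'a list \<Rightarrow> 'a list \<Rightarrow> nat" where
  "hamming x x' = card {i. i < length x \<and> x ! i \<noteq> x' ! i}"

definition neighboring :: "'a set \<Rightarrow> nat \<Rightarrow> 'a list \<Rightarrow> 'a list \<Rightarrow> bool" where
  "neighboring X n x x' \<longleftrightarrow> x \<in> vectors X n \<and> x' \<in> vectors X n \<and> hamming x x' \<le> 1"

text \<open>A randomized mechanism with outputs in the measurable space \<open>N\<close> is a map from inputs to
  probability measures on \<open>N\<close>; the first conjunct states this, so that \<open>measure (M x) S\<close> really is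
  the probability of \<open>M(x) \<in> S\<close>.\<close>
definition differentially_private ::
    "'b measure \<Rightarrow> 'a set \<Rightarrow> nat \<Rightarrow> real \<Rightarrow> ('a list \<Rightarrow> 'b measure) \<Rightarrow> bool" where
  "differentially_private N X n \<epsilon> M \<longleftrightarrow>
     (\<forall>x\<in>vectors X n. M x \<in> space (prob_algebra N)) \<and>
     (\<forall>x x'. neighboring X n x x' \<longrightarrow>
        (\<forall>S\<in>sets N. measure (M x) S \<le> exp \<epsilon> * measure (M x') S))"

text \<open>The exact bounds are taken in \<^typ>\<open>ereal\<close>, as they may be infinite for arbitrary \<open>f\<close>.\<close>
definition upper_bound :: "'a set \<Rightarrow> nat \<Rightarrow> ('a list \<Rightarrow> real) \<Rightarrow> nat \<Rightarrow> 'a list \<Rightarrow> ereal" where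
  "upper_bound X n f l x = (SUP x'\<in>{x'\<in>vectors X n. hamming x x' \<le> l}. ereal (f x'))"

definition lower_bound :: "'a set \<Rightarrow> nat \<Rightarrow> ('a list \<Rightarrow> real) \<Rightarrow> nat \<Rightarrow> 'a list \<Rightarrow> ereal" where
  "lower_bound X n f l x = (INF x'\<in>{x'\<in>vectors X n. hamming x x' \<le> l}. ereal (f x'))"

definition approx_upper_bounding ::
    "'a set \<Rightarrow> nat \<Rightarrow> ('a list \<Rightarrow> real) \<Rightarrow> (nat \<Rightarrow> 'a list \<Rightarrow> real) \<Rightarrow> bool" where
  "approx_upper_bounding X n f U \<longleftrightarrow>
     (\<forall>l. \<forall>x\<in>vectors X n. ereal (U l x) \<ge> upper_bound X n f l x) \<and>
     (\<forall>l x x'. neighboring X n x x' \<longrightarrow> U l x \<le> U (Suc l) x')"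

definition approx_lower_bounding ::
    "'a set \<Rightarrow> nat \<Rightarrow> ('a list \<Rightarrow> real) \<Rightarrow> (nat \<Rightarrow> 'a list \<Rightarrow> real) \<Rightarrow> bool" where
  "approx_lower_bounding X n f L \<longleftrightarrow>
     (\<forall>l. \<forall>x\<in>vectors X n. ereal (L l x) \<le> lower_bound X n f l x) \<and>
     (\<forall>l x x'. neighboring X n x x' \<longrightarrow> L l x \<ge> L (Suc l) x')"

text \<open>In \<^typ>\<open>enat\<close> the infimum of the empty set is \<open>\<infinity>\<close>.\<close>
definition approx_len ::
    "(nat \<Rightarrow> 'a list \<Rightarrow> real) \<Rightarrow> (nat \<Rightarrow> 'a list \<Rightarrow> real) \<Rightarrow> 'a list \<Rightarrow> real \<Rightarrow> enat" where
  "approx_len U L x t = Inf {enat l | l. L l x \<le> t \<and> t \<le> U l x}"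

text \<open>Note that \<^prop>\<open>(0::ereal) * \<infinity> = 0\<close>, so the value is \<open>0\<close> whenever \<open>t = f x\<close>.\<close>
definition approx_rho ::
    "('a list \<Rightarrow> real) \<Rightarrow> (nat \<Rightarrow> 'a list \<Rightarrow> real) \<Rightarrow> (nat \<Rightarrow> 'a list \<Rightarrow> real) \<Rightarrow>
     'a list \<Rightarrow> real \<Rightarrow> ereal" where
  "approx_rho f U L x t =
     ereal (sgn (t - f x)) * (ereal_of_enat (approx_len U L x t) - ereal (1 / 2))"

text \<open>Streams are indexed from \<open>0\<close>. A transcript that outputs \<open>\<bottom>\<close> exactly \<open>k\<close> times and then
  \<open>\<top>\<close> is encoded as \<open>Some k\<close>; the infinite transcript consisting of \<open>\<bottom>\<close> only is \<open>None\<close>.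
  The argument \<open>z\<close> is the threshold noise and \<open>\<nu> i\<close> the noise added to the query value \<open>v i\<close>.\<close>
definition above_threshold_run ::
    "(nat \<Rightarrow> ereal) \<Rightarrow> real \<Rightarrow> real \<Rightarrow> (nat \<Rightarrow> real) \<Rightarrow> nat option" where
  "above_threshold_run v T z \<nu> =
     (if \<exists>i. v i + ereal (\<nu> i) \<ge> ereal (T + z)
      then Some (LEAST i. v i + ereal (\<nu> i) \<ge> ereal (T + z))
      else None)"

definition exponential_noise :: "real \<Rightarrow> real measure" where
  "exponential_noise s = density lborel (exponential_density (1 / s))"

definition above_threshold ::
    "(nat \<Rightarrow> 'a list \<Rightarrow> ereal) \<Rightarrow> real \<Rightarrow> real \<Rightarrow> real \<Rightarrow> real \<Rightarrow> 'a list \<Rightarrow> nat option measure" where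
  "above_threshold q \<Delta> T \<epsilon>1 \<epsilon>2 x =
     distr (exponential_noise (\<Delta> / \<epsilon>1) \<Otimes>\<^sub>M (\<Pi>\<^sub>M i\<in>(UNIV::nat set). exponential_noise (\<Delta> / \<epsilon>2)))
       (count_space UNIV)
       (\<lambda>(z, \<nu>). above_threshold_run (\<lambda>i. q i x) T z \<nu>)"

definition monotonic_stream :: "'a set \<Rightarrow> nat \<Rightarrow> (nat \<Rightarrow> 'a list \<Rightarrow> ereal) \<Rightarrow> bool" where
  "monotonic_stream X n q \<longleftrightarrow>
     (\<forall>x x'. neighboring X n x x' \<longrightarrow> (\<forall>i. q i x \<le> q i x') \<or> (\<forall>i. q i x \<ge> q i x'))"

text \<open>The Borel space on the reals with one isolated point \<^term>\<open>None\<close> added, standing for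
  ``no value is ever returned''.\<close>
definition output_space :: "real option measure" where
  "output_space = sigma UNIV {S. Some -` S \<in> sets borel}"

definition threshold_mechanism ::
    "('a list \<Rightarrow> real) \<Rightarrow> (nat \<Rightarrow> 'a list \<Rightarrow> real) \<Rightarrow> (nat \<Rightarrow> 'a list \<Rightarrow> real) \<Rightarrow>
     (nat \<Rightarrow> real) \<Rightarrow> real \<Rightarrow> real \<Rightarrow> 'a list \<Rightarrow> real option measure" where
  "threshold_mechanism f U L t \<epsilon>1 \<epsilon>2 x =
     distr (above_threshold (\<lambda>i y. approx_rho f U L y (t i)) 1 0 \<epsilon>1 \<epsilon>2 x)
       output_space (map_option t)"

end

theory Submission
  imports Defs
begin

text \<open>Shifting the threshold noise by \<open>c\<close> and the noise of the \<open>k\<close>-th query by \<open>d\<close> maps the event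
  ``output at step \<open>k\<close>'' for \<open>x\<close> into the same event for \<open>x'\<close>, provided that
  \<open>q\<^sub>i(x') \<le> q\<^sub>i(x) + c \<le> q\<^sub>i(x') + d\<close>, and costs a factor \<open>exp (c\<epsilon>\<^sub>1 + d\<epsilon>\<^sub>2)\<close> in probability.
  Since \<open>approx_rho\<close> changes by at most \<open>1\<close> between neighbors, \<open>(c, d) = (1, 2)\<close> always works;
  for a monotonic stream one of \<open>(1, 1)\<close> and \<open>(0, 1)\<close> does. The event of no output needs
  only the shift by \<open>c\<close>.\<close>

section \<open>Sensitivity of \<open>approx_len\<close> and \<open>approx_rho\<close> between
  neighbors\<close>

lemma neighboring_sym:
  assumes "neighboring X n x x'"
  shows "neighboring X n x' x"
proof -
  have "length x = length x'"
    using assms by (auto simp: neighboring_def vectors_def)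
  then have "hamming x' x = hamming x x'"
    unfolding hamming_def by (metis (mono_tags, lifting))
  then show ?thesis using assms by (auto simp: neighboring_def)
qed

lemma hamming_self [simp]: "hamming x x = 0"
  by (simp add: hamming_def)

lemma approx_upper_boundingD:
  assumes "approx_upper_bounding X n f U" "x \<in> vectors X n" "y \<in> vectors X n" "hamming x y \<le> l"
  shows "f y \<le> U l x"
proof -
  have "ereal (f y) \<le> upper_bound X n f l x"
    unfolding upper_bound_def using assms by (intro SUP_upper) auto
  also have "\<dots> \<le> ereal (U l x)"
    using assms by (auto simp: approx_upper_bounding_def)
  finally show ?thesis by simp
qed

lemma approx_lower_boundingD:
  assumes "approx_lower_bounding X n f L" "x \<in> vectors X n" "y \<in> vectors X n" "hamming x y \<le> l"
  shows "L l x \<le> f y"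
proof -
  have "ereal (L l x) \<le> lower_bound X n f l x"
    using assms by (auto simp: approx_lower_bounding_def)
  also have "\<dots> \<le> ereal (f y)"
    unfolding lower_bound_def using assms by (intro INF_lower) auto
  finally show ?thesis by simp
qed

lemma approx_len_leI: "L l x \<le> t \<Longrightarrow> t \<le> U l x \<Longrightarrow> approx_len U L x t \<le> enat l"
  unfolding approx_len_def by (rule Inf_lower) auto

text \<open>A finite value excludes the empty set, whose infimum is infinite, and a nonempty set in
  \<open>enat\<close> has a least element, so the infimum is attained.\<close>

lemma approx_len_enatD:
  assumes "approx_len U L x t = enat l"
  shows "L l x \<le> t" "t \<le> U l x"
proof -
  let ?A = "{enat l | l. L l x \<le> t \<and> t \<le> U l x}"
  have "?A \<noteq> {}"
    using assms by (auto simp: approx_len_def Inf_enat_def split: if_splits)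
  then have "Inf ?A \<in> ?A"
    unfolding Inf_enat_def by (auto intro: LeastI)
  then show "L l x \<le> t" "t \<le> U l x"
    using assms by (auto simp: approx_len_def)
qed

text \<open>A level \<open>l\<close> that works at \<open>x\<close> makes \<open>Suc l\<close> work
  at \<open>x'\<close>, because the interval \<open>[L l x, U l x]\<close> lies inside
  \<open>[L (Suc l) x', U (Suc l) x']\<close>. If the length at \<open>x\<close> is infinite, the
  bound is trivial.\<close>

lemma approx_len_neighboring:
  assumes "approx_upper_bounding X n f U" "approx_lower_bounding X n f L" "neighboring X n x x'"
  shows "approx_len U L x' t \<le> approx_len U L x t + 1"
proof (cases "approx_len U L x t")
  case (enat l)
  have "L (Suc l) x' \<le> L l x" "U l x \<le> U (Suc l) x'"
    using assms by (auto simp: approx_upper_bounding_def approx_lower_bounding_def)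
  with approx_len_enatD[OF enat] have "L (Suc l) x' \<le> t" "t \<le> U (Suc l) x'"
    by linarith+
  then show ?thesis
    using approx_len_leI[of L "Suc l" x' t U] enat by (simp add: one_enat_def)
qed simp

text \<open>Both \<open>y\<close> and \<open>z\<close> lie within distance \<open>l\<close> of
  \<open>x\<close>, which gives the chain \<open>L l x <= f y <= t <= f z <= U l x\<close>.\<close>

lemma approx_len_between:
  assumes "approx_upper_bounding X n f U" "approx_lower_bounding X n f L"
    and "x \<in> vectors X n" "y \<in> vectors X n" "z \<in> vectors X n"
    and "hamming x y \<le> l" "hamming x z \<le> l" "f y \<le> t" "t \<le> f z"
  shows "approx_len U L x t \<le> enat l"
  using approx_upper_boundingD[of X n f U x z l] approx_lower_boundingD[of X n f L x y l] assms
  by (intro approx_len_leI) auto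

text \<open>If \<open>t\<close> separates \<open>f x\<close> and \<open>f x'\<close>, both lengths are at most \<open>1\<close> and the two values of
  \<open>approx_rho\<close> lie in \<open>[-1/2, 1/2]\<close>; otherwise the signs agree.\<close>
lemma approx_rho_neighboring:
  assumes U: "approx_upper_bounding X n f U" and L: "approx_lower_bounding X n f L"
    and nb: "neighboring X n x x'"
  shows "approx_rho f U L x' t \<le> approx_rho f U L x t + 1"
proof -
  note nb' = neighboring_sym[OF nb]
  have mem: "x \<in> vectors X n" "x' \<in> vectors X n" "hamming x x' \<le> 1" "hamming x' x \<le> 1"
    using nb nb' by (auto simp: neighboring_def)
  let ?a = "approx_len U L x t" and ?b = "approx_len U L x' t"
  have le: "?b \<le> ?a + 1" "?a \<le> ?b + 1"
    using approx_len_neighboring[OF U L nb] approx_len_neighboring[OF U L nb'] by auto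
  \<comment> \<open>The ball of radius 1 around either list contains both lists, so each center sees
    a value of \<open>f\<close> on either side of \<open>t\<close>.\<close>
  have sep: "?a \<le> enat 1" "?b \<le> enat 1" if "f x \<le> t \<and> t \<le> f x' \<or> f x' \<le> t \<and> t \<le> f x"
    using that mem approx_len_between[OF U L, of x x x' 1 t] approx_len_between[OF U L, of x x' x 1 t]
      approx_len_between[OF U L, of x' x x' 1 t] approx_len_between[OF U L, of x' x' x 1 t]
    by (auto simp: one_enat_def[symmetric])
  show ?thesis
  proof (cases ?a)
    case (enat a)
    with le obtain b where b: "?b = enat b" "b \<le> a + 1" "a \<le> b + 1"
      by (cases ?b) (auto simp: one_enat_def)
    show ?thesis
    proof (cases "f x \<le> t \<and> t \<le> f x' \<or> f x' \<le> t \<and> t \<le> f x")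
      case True
      with sep enat b have ab: "real a \<le> 1" "real b \<le> 1" by auto
      have "sgn (t - f x) * (real a - 1 / 2) \<ge> -1 / 2" "sgn (t - f x') * (real b - 1 / 2) \<le> 1 / 2"
        using ab by (auto simp: sgn_if)
      then show ?thesis
        unfolding approx_rho_def enat b by (simp add: one_ereal_def)
    next
      case False
      then have "sgn (t - f x) = sgn (t - f x')" "sgn (t - f x) = 1 \<or> sgn (t - f x) = -1"
        by (auto simp: sgn_if)
      then show ?thesis
        unfolding approx_rho_def enat b using b(2,3)
        by (auto simp: one_ereal_def)
    qed
  next
    case infinity
    with le have b: "?b = \<infinity>" by (cases ?b) (auto simp: one_enat_def)
    \<comment> \<open>Separation would make the length finite by \<open>sep\<close>. Hence
      \<open>t\<close> lies strictly on the same side of \<open>f x\<close> and \<open>f x'\<close>,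
      and both values of \<open>approx_rho\<close> are the same infinity.\<close>
    have "\<not> (f x \<le> t \<and> t \<le> f x' \<or> f x' \<le> t \<and> t \<le> f x)"
      using sep infinity by auto
    then have "sgn (t - f x) = sgn (t - f x')" "sgn (t - f x) = 1 \<or> sgn (t - f x) = -1"
      by (auto simp: sgn_if)
    then show ?thesis
      unfolding approx_rho_def infinity b by auto
  qed
qed

section \<open>Cost of shifting exponential noise\<close>

lemma prob_space_exponential_noise: "0 < s \<Longrightarrow> prob_space (exponential_noise s)"
  unfolding exponential_noise_def by (rule prob_space_exponential_density) simp

lemma sets_exponential_noise [simp, measurable_cong]: "sets (exponential_noise s) = sets borel"
  by (simp add: exponential_noise_def)

lemma space_exponential_noise [simp]: "space (exponential_noise s) = UNIV"
  by (simp add: exponential_noise_def)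

text \<open>For \<open>x >= 0\<close> the density at \<open>x\<close> is exactly
  \<open>exp (c * \<epsilon>)\<close> times the density at \<open>x + c\<close>, and for negative
  \<open>x\<close> it is zero. The noise is one-sided, so the comparison relies on
  \<open>0 <= c\<close>. Translation invariance of Lebesgue measure then removes the shift.\<close>

lemma nn_integral_exponential_noise_shift:
  assumes [measurable]: "f \<in> borel_measurable borel" and "0 < \<epsilon>" "0 \<le> c"
  shows "(\<integral>\<^sup>+x. f (x + c) \<partial>exponential_noise (1 / \<epsilon>))
    \<le> ennreal (exp (c * \<epsilon>)) * (\<integral>\<^sup>+x. f x \<partial>exponential_noise (1 / \<epsilon>))"
proof -
  have "(\<integral>\<^sup>+x. f (x + c) \<partial>exponential_noise (1 / \<epsilon>))
      = (\<integral>\<^sup>+x. ennreal (exponential_density \<epsilon> x) * f (x + c) \<partial>lborel)"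
    unfolding exponential_noise_def by (subst nn_integral_density) (auto simp: exponential_density_def)
  also have "\<dots> \<le> (\<integral>\<^sup>+x. ennreal (exp (c * \<epsilon>)) * (ennreal (exponential_density \<epsilon> (x + c)) * f (x + c)) \<partial>lborel)"
  proof (intro nn_integral_mono)
    fix x
    have "exponential_density \<epsilon> x \<le> exp (c * \<epsilon>) * exponential_density \<epsilon> (x + c)"
      using assms by (auto simp: exponential_density_def exp_add[symmetric] algebra_simps)
    then have "ennreal (exponential_density \<epsilon> x)
        \<le> ennreal (exp (c * \<epsilon>)) * ennreal (exponential_density \<epsilon> (x + c))"
      using assms by (simp add: ennreal_mult[symmetric] exponential_density_nonneg ennreal_leI)
    then show "ennreal (exponential_density \<epsilon> x) * f (x + c)
        \<le> ennreal (exp (c * \<epsilon>)) * (ennreal (exponential_density \<epsilon> (x + c)) * f (x + c))"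
      unfolding mult.assoc[symmetric] by (intro mult_right_mono) auto
  qed
  also have "\<dots> = ennreal (exp (c * \<epsilon>)) * (\<integral>\<^sup>+x. ennreal (exponential_density \<epsilon> (x + c)) * f (x + c) \<partial>lborel)"
    by (intro nn_integral_cmult) measurable
  also have "(\<integral>\<^sup>+x. ennreal (exponential_density \<epsilon> (x + c)) * f (x + c) \<partial>lborel)
      = (\<integral>\<^sup>+x. ennreal (exponential_density \<epsilon> x) * f x \<partial>lborel)"
    by (subst nn_integral_real_affine[where c = 1 and t = c]) (auto simp: add.commute)
  also have "\<dots> = (\<integral>\<^sup>+x. f x \<partial>exponential_noise (1 / \<epsilon>))"
    unfolding exponential_noise_def by (subst nn_integral_density) (auto simp: exponential_density_def)
  finally show ?thesis .
qed

text \<open>Fubini isolates coordinate \<open>k\<close>; with the other coordinates fixed, this is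
  the one-dimensional shift.\<close>

lemma nn_integral_PiM_shift:
  fixes f :: "('i \<Rightarrow> real) \<Rightarrow> ennreal"
  defines "N \<equiv> (\<lambda>\<epsilon>. \<Pi>\<^sub>M i\<in>(UNIV::'i set). exponential_noise (1 / \<epsilon>))"
  assumes f: "f \<in> borel_measurable (N \<epsilon>)" and "0 < \<epsilon>" "0 \<le> d"
  shows "(\<integral>\<^sup>+\<nu>. f (\<nu>(k := \<nu> k + d)) \<partial>N \<epsilon>) \<le> ennreal (exp (d * \<epsilon>)) * (\<integral>\<^sup>+\<nu>. f \<nu> \<partial>N \<epsilon>)"
proof -
  let ?E = "exponential_noise (1 / \<epsilon>)"
  let ?R = "\<Pi>\<^sub>M i\<in>UNIV - {k}. ?E"
  have E: "prob_space ?E" using assms by (intro prob_space_exponential_noise) simp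
  interpret E: prob_space ?E by fact
  interpret R: prob_space ?R by (intro prob_space_PiM E)
  interpret ER: pair_sigma_finite ?E ?R ..
  \<comment> \<open>The infinite product arises by inserting an independent value at
    \<open>k\<close> into a sample over the remaining indices, which reduces it to a product of two
    factors.\<close>
  have N: "N \<epsilon> = distr (?E \<Otimes>\<^sub>M ?R) (N \<epsilon>) (\<lambda>(x, \<nu>). \<nu>(k := x))"
    using distr_pair_PiM_eq_PiM[of "UNIV - {k}" "\<lambda>_. ?E" k] E by (simp add: N_def insert_absorb)
  have upd: "(\<lambda>(x, \<nu>). \<nu>(k := x)) \<in> ?E \<Otimes>\<^sub>M ?R \<rightarrow>\<^sub>M N \<epsilon>"
    using measurable_fun_upd[of UNIV "UNIV - {k}" k snd "?E \<Otimes>\<^sub>M ?R" "\<lambda>_. ?E" fst]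
    by (simp add: N_def case_prod_beta' insert_absorb)
  have int: "(\<integral>\<^sup>+\<nu>. g \<nu> \<partial>N \<epsilon>) = (\<integral>\<^sup>+\<nu>. \<integral>\<^sup>+x. g (\<nu>(k := x)) \<partial>?E \<partial>?R)"
    if g: "g \<in> borel_measurable (N \<epsilon>)" for g
  proof -
    have "(\<integral>\<^sup>+\<nu>. g \<nu> \<partial>N \<epsilon>) = (\<integral>\<^sup>+p. g (case p of (x, \<nu>) \<Rightarrow> \<nu>(k := x)) \<partial>(?E \<Otimes>\<^sub>M ?R))"
      by (subst N, subst nn_integral_distr[OF upd]) (use g in auto)
    also have "\<dots> = (\<integral>\<^sup>+\<nu>. \<integral>\<^sup>+x. g (\<nu>(k := x)) \<partial>?E \<partial>?R)"
      by (subst ER.nn_integral_snd[symmetric]) (use measurable_compose[OF upd g] in auto)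
    finally show ?thesis .
  qed
  have shift: "(\<lambda>\<nu>. \<nu>(k := \<nu> k + d)) \<in> N \<epsilon> \<rightarrow>\<^sub>M N \<epsilon>"
    unfolding N_def by (rule measurable_fun_upd[where J=UNIV]) auto
  have sec: "(\<lambda>x. f (\<nu>(k := x))) \<in> borel_measurable borel" if "\<nu> \<in> space ?R" for \<nu>
    using measurable_compose[OF measurable_Pair2'[OF that] measurable_compose[OF upd f]] by simp
  have "(\<integral>\<^sup>+\<nu>. f (\<nu>(k := \<nu> k + d)) \<partial>N \<epsilon>) = (\<integral>\<^sup>+\<nu>. \<integral>\<^sup>+x. f (\<nu>(k := x + d)) \<partial>?E \<partial>?R)"
    by (subst int) (use measurable_compose[OF shift f] in auto)
  also have "\<dots> \<le> (\<integral>\<^sup>+\<nu>. ennreal (exp (d * \<epsilon>)) * (\<integral>\<^sup>+x. f (\<nu>(k := x)) \<partial>?E) \<partial>?R)"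
    using assms sec by (intro nn_integral_mono nn_integral_exponential_noise_shift) auto
  also have "\<dots> = ennreal (exp (d * \<epsilon>)) * (\<integral>\<^sup>+\<nu>. \<integral>\<^sup>+x. f (\<nu>(k := x)) \<partial>?E \<partial>?R)"
    \<comment> \<open>Swapping the factors puts the variable \<open>x\<close> last, as required for
      the inner integral to be measurable in \<nu>.\<close>
    using measurable_compose[OF measurable_pair_swap' measurable_compose[OF upd f]]
    by (intro nn_integral_cmult E.borel_measurable_nn_integral) (simp add: case_prod_beta')
  finally show ?thesis by (simp add: int[OF f])
qed

text \<open>By independence the shifts act in turn: first on \<nu> with \<open>z\<close> fixed, then
  on \<open>z\<close> with \<nu> integrated out. The two factors multiply.\<close>

lemma nn_integral_noise_shift:
  fixes g :: "real \<times> ('i \<Rightarrow> real) \<Rightarrow> ennreal"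
  defines "N \<equiv> (\<lambda>\<epsilon>. \<Pi>\<^sub>M i\<in>(UNIV::'i set). exponential_noise (1 / \<epsilon>))"
  defines "P \<equiv> (\<lambda>\<epsilon>1 \<epsilon>2. exponential_noise (1 / \<epsilon>1) \<Otimes>\<^sub>M N \<epsilon>2)"
  assumes g: "g \<in> borel_measurable (P \<epsilon>1 \<epsilon>2)" and "0 < \<epsilon>1" "0 < \<epsilon>2" "0 \<le> c" "0 \<le> d"
  shows "(\<integral>\<^sup>+(z, \<nu>). g (z + c, \<nu>(k := \<nu> k + d)) \<partial>P \<epsilon>1 \<epsilon>2)
    \<le> ennreal (exp (c * \<epsilon>1 + d * \<epsilon>2)) * (\<integral>\<^sup>+p. g p \<partial>P \<epsilon>1 \<epsilon>2)"
proof -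
  let ?E = "exponential_noise (1 / \<epsilon>1)"
  interpret N: prob_space "N \<epsilon>2"
    unfolding N_def using assms by (intro prob_space_PiM prob_space_exponential_noise) simp
  have g' [measurable]: "g \<in> borel_measurable (borel \<Otimes>\<^sub>M N \<epsilon>2)"
    using g by (simp add: P_def cong: measurable_cong_sets sets_pair_measure_cong)
  have shift [measurable]: "(\<lambda>\<nu>. \<nu>(k := \<nu> k + d)) \<in> N \<epsilon>2 \<rightarrow>\<^sub>M N \<epsilon>2"
    unfolding N_def by (rule measurable_fun_upd[where J=UNIV]) auto
  have "(\<integral>\<^sup>+(z, \<nu>). g (z + c, \<nu>(k := \<nu> k + d)) \<partial>P \<epsilon>1 \<epsilon>2)
      = (\<integral>\<^sup>+z. \<integral>\<^sup>+\<nu>. g (z + c, \<nu>(k := \<nu> k + d)) \<partial>N \<epsilon>2 \<partial>?E)"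
    unfolding P_def by (subst N.nn_integral_fst[symmetric]) auto
  also have "\<dots> \<le> (\<integral>\<^sup>+z. ennreal (exp (d * \<epsilon>2)) * (\<integral>\<^sup>+\<nu>. g (z + c, \<nu>) \<partial>N \<epsilon>2) \<partial>?E)"
    using assms(5,7) g' unfolding N_def
    by (intro nn_integral_mono nn_integral_PiM_shift) auto
  also have "\<dots> = ennreal (exp (d * \<epsilon>2)) * (\<integral>\<^sup>+z. \<integral>\<^sup>+\<nu>. g (z + c, \<nu>) \<partial>N \<epsilon>2 \<partial>?E)"
    by (intro nn_integral_cmult) measurable
  also have "\<dots> \<le> ennreal (exp (d * \<epsilon>2)) *
      (ennreal (exp (c * \<epsilon>1)) * (\<integral>\<^sup>+z. \<integral>\<^sup>+\<nu>. g (z, \<nu>) \<partial>N \<epsilon>2 \<partial>?E))"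
    using assms(4,6) by (intro mult_left_mono nn_integral_exponential_noise_shift) auto
  also have "\<dots> = ennreal (exp (c * \<epsilon>1 + d * \<epsilon>2)) * (\<integral>\<^sup>+p. g p \<partial>P \<epsilon>1 \<epsilon>2)"
    unfolding P_def by (subst N.nn_integral_fst) (auto simp: exp_add ennreal_mult mult_ac)
  finally show ?thesis .
qed

section \<open>Single runs of AboveThreshold with fixed noise\<close>

lemma above_threshold_run_eq_None:
  "above_threshold_run v T z \<nu> = None \<longleftrightarrow> (\<forall>i. v i + ereal (\<nu> i) < ereal (T + z))"
  unfolding above_threshold_run_def not_le[symmetric] by simp

lemma above_threshold_run_eq_Some:
  "above_threshold_run v T z \<nu> = Some k \<longleftrightarrow>
    ereal (T + z) \<le> v k + ereal (\<nu> k) \<and> (\<forall>i<k. v i + ereal (\<nu> i) < ereal (T + z))"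
  (is "_ \<longleftrightarrow> ?Q k \<and> _")
proof
  assume "above_threshold_run v T z \<nu> = Some k"
  then have "\<exists>i. ?Q i" "k = (LEAST i. ?Q i)"
    by (auto simp: above_threshold_run_def split: if_splits)
  then show "?Q k \<and> (\<forall>i<k. v i + ereal (\<nu> i) < ereal (T + z))"
    by (metis (mono_tags, lifting) LeastI_ex not_less_Least not_le)
next
  assume *: "?Q k \<and> (\<forall>i<k. v i + ereal (\<nu> i) < ereal (T + z))"
  then have "(LEAST i. ?Q i) = k"
    by (metis (mono_tags, lifting) Least_equality not_le)
  with * show "above_threshold_run v T z \<nu> = Some k"
    by (auto simp: above_threshold_run_def)
qed

text \<open>Query values may be infinite, since \<open>approx_len\<close> may be; the case split
  here and in the next lemma covers these values, while noise and shifts stay real.\<close>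

lemma ereal_noise_less_shift:
  fixes v v' :: ereal
  assumes "v' \<le> v + ereal c" "v + ereal x < ereal z"
  shows "v' + ereal x < ereal (z + c)"
  using assms by (cases v; cases v') auto

lemma ereal_noise_le_shift:
  fixes v v' :: ereal
  assumes "v + ereal c \<le> v' + ereal d" "ereal z \<le> v + ereal x"
  shows "ereal (z + c) \<le> v' + ereal (x + d)"
  using assms by (cases v; cases v') auto

text \<open>Answers below the threshold stay below because the threshold rises by \<open>c\<close>,
  at least as much as any value does. The halting answer stays above because \<open>d\<close> pays
  for the rise \<open>c\<close> and for any drop of the \<open>k\<close>-th value. The noise before
  step \<open>k\<close> is unchanged.\<close>

lemma above_threshold_run_shift:
  assumes v: "\<And>i. v' i \<le> v i + ereal c" "\<And>i. v i + ereal c \<le> v' i + ereal d"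
  shows "above_threshold_run v T z \<nu> = None \<Longrightarrow> above_threshold_run v' T (z + c) \<nu> = None"
    and "above_threshold_run v T z \<nu> = Some k \<Longrightarrow>
      above_threshold_run v' T (z + c) (\<nu>(k := \<nu> k + d)) = Some k"
proof -
  have less: "v' i + ereal (\<nu> i) < ereal (T + (z + c))" if "v i + ereal (\<nu> i) < ereal (T + z)" for i
    using ereal_noise_less_shift[OF v(1) that] by (simp only: add.assoc)
  have le: "ereal (T + (z + c)) \<le> v' k + ereal (\<nu> k + d)" if "ereal (T + z) \<le> v k + ereal (\<nu> k)"
    using ereal_noise_le_shift[OF v(2) that] by (simp only: add.assoc)
  show "above_threshold_run v T z \<nu> = None \<Longrightarrow> above_threshold_run v' T (z + c) \<nu> = None"
    unfolding above_threshold_run_eq_None using less by blast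
  show "above_threshold_run v T z \<nu> = Some k \<Longrightarrow>
      above_threshold_run v' T (z + c) (\<nu>(k := \<nu> k + d)) = Some k"
    unfolding above_threshold_run_eq_Some using less le by (simp del: plus_ereal.simps)
qed

lemma measurable_above_threshold_run:
  "(\<lambda>(z, \<nu>). above_threshold_run v T z \<nu>)
    \<in> exponential_noise a \<Otimes>\<^sub>M (\<Pi>\<^sub>M i\<in>UNIV. exponential_noise b) \<rightarrow>\<^sub>M count_space UNIV"
    (is "_ \<in> ?P \<rightarrow>\<^sub>M _")
proof -
  have [measurable]: "(\<lambda>p. snd p i) \<in> borel_measurable ?P" for i
    using measurable_compose[OF measurable_snd measurable_component_singleton] by fastforce
  have [measurable]: "fst \<in> borel_measurable ?P"
    using measurable_fst by fastforce
  show ?thesis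
    unfolding above_threshold_run_def case_prod_beta' by measurable
qed

section \<open>Distribution of the transcript of AboveThreshold\<close>

lemma prob_space_above_threshold:
  assumes "0 < \<Delta> / \<epsilon>1" "0 < \<Delta> / \<epsilon>2"
  shows "prob_space (above_threshold q \<Delta> T \<epsilon>1 \<epsilon>2 x)"
proof -
  interpret N: prob_space "\<Pi>\<^sub>M i\<in>(UNIV::nat set). exponential_noise (\<Delta> / \<epsilon>2)"
    using assms by (intro prob_space_PiM prob_space_exponential_noise) simp
  interpret E: prob_space "exponential_noise (\<Delta> / \<epsilon>1)"
    using assms by (intro prob_space_exponential_noise) simp
  interpret pair_prob_space "exponential_noise (\<Delta> / \<epsilon>1)" "\<Pi>\<^sub>M i\<in>(UNIV::nat set). exponential_noise (\<Delta> / \<epsilon>2)" ..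
  show ?thesis
    unfolding above_threshold_def by (intro prob_space_distr measurable_above_threshold_run)
qed

lemma sets_above_threshold [simp, measurable_cong]:
  "sets (above_threshold q \<Delta> T \<epsilon>1 \<epsilon>2 x) = UNIV"
  by (simp add: above_threshold_def)

lemma space_above_threshold [simp]: "space (above_threshold q \<Delta> T \<epsilon>1 \<epsilon>2 x) = UNIV"
  by (simp add: above_threshold_def)

lemma emeasure_above_threshold_singleton:
  fixes T \<epsilon>1 \<epsilon>2 c d :: real
  assumes "0 < \<epsilon>1" "0 < \<epsilon>2" "0 \<le> c" "0 \<le> d"
    and q: "\<And>i. q i x' \<le> q i x + ereal c" "\<And>i. q i x + ereal c \<le> q i x' + ereal d"
  shows "emeasure (above_threshold q 1 T \<epsilon>1 \<epsilon>2 x) {r}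
    \<le> ennreal (exp (c * \<epsilon>1 + d * \<epsilon>2)) * emeasure (above_threshold q 1 T \<epsilon>1 \<epsilon>2 x') {r}"
proof -
  let ?P = "exponential_noise (1 / \<epsilon>1) \<Otimes>\<^sub>M (\<Pi>\<^sub>M i\<in>(UNIV::nat set). exponential_noise (1 / \<epsilon>2))"
  let ?run = "\<lambda>y (z, \<nu>). above_threshold_run (\<lambda>i. q i y) T z \<nu>"
  \<comment> \<open>As integrals of indicators over the noise, the probabilities come within reach
    of the shift inequality.\<close>
  have em: "emeasure (above_threshold q 1 T \<epsilon>1 \<epsilon>2 y) {r} = (\<integral>\<^sup>+p. indicator {r} (?run y p) \<partial>?P)" for y
    unfolding above_threshold_def
    by (subst nn_integral_distr[OF measurable_above_threshold_run, symmetric]) auto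
  have meas: "(\<lambda>p. indicator {r} (?run x' p) :: ennreal) \<in> borel_measurable ?P"
    by (rule measurable_compose[OF measurable_above_threshold_run]) simp
  \<comment> \<open>For \<open>None\<close> no query noise has to move, so \<open>d' = 0\<close> at
    the arbitrary index \<open>0\<close>. For \<open>Some k\<close> the noise of the halting query
    moves by the full \<open>d\<close>. The bound \<open>d' <= d\<close> later gives both cases the
    same factor.\<close>
  obtain k d' where k: "0 \<le> d'" "d' \<le> d"
    "\<And>z \<nu>. ?run x (z, \<nu>) = r \<Longrightarrow> ?run x' (z + c, \<nu>(k := \<nu> k + d')) = r"
  proof (cases r)
    case None
    then show thesis
      using above_threshold_run_shift(1)[OF q] assms(4) by (intro that[of 0 0]) auto
  next
    case (Some k)
    then show thesis
      using above_threshold_run_shift(2)[OF q] assms(4) by (intro that[of d k]) auto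
  qed
  have "(\<integral>\<^sup>+p. indicator {r} (?run x p) \<partial>?P)
      \<le> (\<integral>\<^sup>+(z, \<nu>). indicator {r} (?run x' (z + c, \<nu>(k := \<nu> k + d'))) \<partial>?P)"
    using k(3) by (intro nn_integral_mono) (auto simp: indicator_def)
  also have "\<dots> \<le> ennreal (exp (c * \<epsilon>1 + d' * \<epsilon>2)) * (\<integral>\<^sup>+p. indicator {r} (?run x' p) \<partial>?P)"
    by (intro nn_integral_noise_shift meas assms(1-3) k(1))
  also have "\<dots> \<le> ennreal (exp (c * \<epsilon>1 + d * \<epsilon>2)) * (\<integral>\<^sup>+p. indicator {r} (?run x' p) \<partial>?P)"
    using k(2) assms(2) by (intro mult_right_mono ennreal_leI) auto
  finally show ?thesis by (simp add: em)
qed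

text \<open>Transcripts form a countable type, so the probability of \<open>A\<close> is a sum over
  singletons, each of which obeys the bound with the same factor.\<close>

lemma measure_above_threshold_le:
  fixes T \<epsilon>1 \<epsilon>2 c d :: real
  assumes "0 < \<epsilon>1" "0 < \<epsilon>2" "0 \<le> c" "0 \<le> d"
    and "\<And>i. q i x' \<le> q i x + ereal c" "\<And>i. q i x + ereal c \<le> q i x' + ereal d"
  shows "measure (above_threshold q 1 T \<epsilon>1 \<epsilon>2 x) A
    \<le> exp (c * \<epsilon>1 + d * \<epsilon>2) * measure (above_threshold q 1 T \<epsilon>1 \<epsilon>2 x') A"
proof -
  let ?M = "above_threshold q 1 T \<epsilon>1 \<epsilon>2"
  interpret x: prob_space "?M x" using assms(1,2) by (intro prob_space_above_threshold) auto
  interpret x': prob_space "?M x'" using assms(1,2) by (intro prob_space_above_threshold) auto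
  have "emeasure (?M x) A = (\<integral>\<^sup>+r. emeasure (?M x) {r} \<partial>count_space A)"
    by (intro emeasure_countable_singleton) auto
  also have "\<dots> \<le> (\<integral>\<^sup>+r. ennreal (exp (c * \<epsilon>1 + d * \<epsilon>2)) * emeasure (?M x') {r} \<partial>count_space A)"
    by (intro nn_integral_mono emeasure_above_threshold_singleton assms)
  also have "\<dots> = ennreal (exp (c * \<epsilon>1 + d * \<epsilon>2)) * emeasure (?M x') A"
    using emeasure_countable_singleton[of A "?M x'"] by (simp add: nn_integral_cmult)
  finally show ?thesis
    by (simp add: x.emeasure_eq_measure x'.emeasure_eq_measure ennreal_mult[symmetric])
qed

section \<open>Privacy of the returned value\<close>

lemma differentially_private_threshold_mechanism:
  fixes \<epsilon>1 \<epsilon>2 \<epsilon> :: real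
  assumes "0 < \<epsilon>1" "0 < \<epsilon>2"
    and cd: "\<And>x x'. neighboring X n x x' \<Longrightarrow> \<exists>c\<ge>0. \<exists>d\<ge>0. c * \<epsilon>1 + d * \<epsilon>2 \<le> \<epsilon> \<and>
      (\<forall>i. approx_rho f U L x' (t i) \<le> approx_rho f U L x (t i) + ereal c \<and>
           approx_rho f U L x (t i) + ereal c \<le> approx_rho f U L x' (t i) + ereal d)"
  shows "differentially_private output_space X n \<epsilon> (threshold_mechanism f U L t \<epsilon>1 \<epsilon>2)"
  unfolding differentially_private_def
proof safe
  let ?M = "above_threshold (\<lambda>i y. approx_rho f U L y (t i)) 1 0 \<epsilon>1 \<epsilon>2"
  have meas: "map_option t \<in> ?M x \<rightarrow>\<^sub>M output_space" for x
    by (rule measurableI) (simp_all add: output_space_def space_measure_of_conv)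
  {
    fix x
    interpret prob_space "?M x" using assms(1,2) by (intro prob_space_above_threshold) auto
    show "threshold_mechanism f U L t \<epsilon>1 \<epsilon>2 x \<in> space (prob_algebra output_space)"
      unfolding threshold_mechanism_def
      by (auto simp: space_prob_algebra intro!: prob_space_distr meas)
  next
    fix x x' S assume nb: "neighboring X n x x'" and S: "S \<in> sets output_space"
    from cd[OF nb] obtain c d where c: "0 \<le> c" "0 \<le> d" "c * \<epsilon>1 + d * \<epsilon>2 \<le> \<epsilon>"
      "\<And>i. approx_rho f U L x' (t i) \<le> approx_rho f U L x (t i) + ereal c"
      "\<And>i. approx_rho f U L x (t i) + ereal c \<le> approx_rho f U L x' (t i) + ereal d"
      by blast
    \<comment> \<open>Post-processing: the returned value lies in \<open>S\<close> exactly when the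
      transcript lies in \<open>?A\<close>, and the transcript bound holds for every set.\<close>
    let ?A = "map_option t -` S"
    have "measure (?M x) ?A \<le> exp (c * \<epsilon>1 + d * \<epsilon>2) * measure (?M x') ?A"
      by (rule measure_above_threshold_le[OF assms(1,2) c(1,2)]) (rule c(4,5))+
    also have "\<dots> \<le> exp \<epsilon> * measure (?M x') ?A"
      using c(3) by (intro mult_right_mono) auto
    finally show "measure (threshold_mechanism f U L t \<epsilon>1 \<epsilon>2 x) S
        \<le> exp \<epsilon> * measure (threshold_mechanism f U L t \<epsilon>1 \<epsilon>2 x') S"
      unfolding threshold_mechanism_def by (simp add: measure_distr[OF meas S])
  }
qed

theorem theorem3p9:
  fixes X :: "'a set" and n :: nat and f :: "'a list \<Rightarrow> real"
    and U L :: "nat \<Rightarrow> 'a list \<Rightarrow> real" and t :: "nat \<Rightarrow> real" and \<epsilon>1 \<epsilon>2 :: real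
  assumes "n \<ge> 1"
    and "approx_upper_bounding X n f U"
    and "approx_lower_bounding X n f L"
    and "\<epsilon>1 > 0" and "\<epsilon>2 > 0"
  shows "differentially_private output_space X n (\<epsilon>1 + 2 * \<epsilon>2)
           (threshold_mechanism f U L t \<epsilon>1 \<epsilon>2) \<and>
         (monotonic_stream X n (\<lambda>i x. approx_rho f U L x (t i)) \<longrightarrow>
            differentially_private output_space X n (\<epsilon>1 + \<epsilon>2)
              (threshold_mechanism f U L t \<epsilon>1 \<epsilon>2))"
proof (intro conjI impI)
  let ?q = "\<lambda>i x. approx_rho f U L x (t i)"
  have sens: "?q i x' \<le> ?q i x + 1" "?q i x \<le> ?q i x' + 1" if "neighboring X n x x'" for i x x'
    by (intro approx_rho_neighboring[OF assms(2,3)] that neighboring_sym)+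
  \<comment> \<open>Adding 1 to the sensitivity bound in the opposite direction yields the second
    shift condition for \<open>c = 1\<close>, \<open>d = 2\<close>.\<close>
  have two: "a + ereal 1 \<le> b + ereal 2" if "a \<le> b + 1" for a b :: ereal
    using that by (cases a; cases b) (auto simp: one_ereal_def)
  show "differentially_private output_space X n (\<epsilon>1 + 2 * \<epsilon>2) (threshold_mechanism f U L t \<epsilon>1 \<epsilon>2)"
  proof (rule differentially_private_threshold_mechanism[OF assms(4,5)])
    fix x x' assume nb: "neighboring X n x x'"
    show "\<exists>c\<ge>0. \<exists>d\<ge>0. c * \<epsilon>1 + d * \<epsilon>2 \<le> \<epsilon>1 + 2 * \<epsilon>2 \<and>
      (\<forall>i. ?q i x' \<le> ?q i x + ereal c \<and> ?q i x + ereal c \<le> ?q i x' + ereal d)"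
      using sens(1)[OF nb] two[OF sens(2)[OF nb]]
      by (intro exI[of _ 1] exI[of _ 2] conjI allI) (simp_all add: one_ereal_def)
  qed
  assume mono: "monotonic_stream X n ?q"
  show "differentially_private output_space X n (\<epsilon>1 + \<epsilon>2) (threshold_mechanism f U L t \<epsilon>1 \<epsilon>2)"
  proof (rule differentially_private_threshold_mechanism[OF assms(4,5)])
    fix x x' assume nb: "neighboring X n x x'"
    with mono consider "\<And>i. ?q i x \<le> ?q i x'" | "\<And>i. ?q i x' \<le> ?q i x"
      by (auto simp: monotonic_stream_def)
    then show "\<exists>c\<ge>0. \<exists>d\<ge>0. c * \<epsilon>1 + d * \<epsilon>2 \<le> \<epsilon>1 + \<epsilon>2 \<and>
      (\<forall>i. ?q i x' \<le> ?q i x + ereal c \<and> ?q i x + ereal c \<le> ?q i x' + ereal d)"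
    proof cases
      \<comment> \<open>Values rise towards \<open>x'\<close>: sensitivity justifies
        \<open>c = 1\<close>, and monotonicity gives the second condition already with
        \<open>d = 1\<close>.\<close>
      case 1
      then show ?thesis
        using sens(1)[OF nb] add_right_mono[OF 1]
        by (intro exI[of _ 1] conjI allI) (simp_all add: one_ereal_def)
    next
      \<comment> \<open>Values fall towards \<open>x'\<close>: the threshold noise stays put with
        \<open>c = 0\<close>, and \<open>d = 1\<close> covers the fall. The cost is only
        \<open>\<epsilon>2\<close>, which is below the claimed sum as \<open>\<epsilon>1\<close> is
        positive.\<close>
      case 2
      then show ?thesis
        using 2 sens(2)[OF nb] assms(4)
        by (intro exI[of _ 0] exI[of _ 1] conjI allI) (simp_all add: one_ereal_def zero_ereal_def[symmetric])
    qed
  qed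
qed

end
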